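(* Let $r$ be a positive integer, let $A$ be a finite set of $k \geq 6$ positive integers, and let $H$ be a set of $t \geq 2$ positive integers with $1 \leq r \leq \max(H) \leq (k-1)r-1$. If \[ |H^{(r)}A| = \mathcal{L}_k(H,r), \] then $H$ is an arithmetic progression with common difference $d \leq r$ and $A$ is an arithmetic progression with common difference $d\cdot \min(A)$.
   Context: For a finite set $A=\{a_1,\ldots,a_k\}$ of integers and positive integers $h, r$, $h^{(r)}A=\{\sum_{i=1}^k \lambda_i a_i : 0\le \lambda_i\le r,\ \sum_{i=1}^k\lambda_i=h\}$, and for a finite set $H$ of positive integers, $H^{(r)}A=\bigcup_{h\in H} h^{(r)}A$. For a set $H=\{h_1<\cdots<h_t\}$ of positive integers, a positive integer $r$ and an integer $k$, put $h_0=0$ and, for $0\le i\le t$, write $h_i=m_i r+\epsilon_i$ with $m_i=\lfloor h_i/r\rfloor$, $0\le \epsilon_i\le r-1$. Define \[\mathcal{L}_k(H,r)=\sum_{i=1}^{t}\Big( r(m_i-m_{i-1})(k-m_i)+(\epsilon_i-\epsilon_{i-1})(k-m_i-1)-\max\{\epsilon_i,\epsilon_{i-1}\}(m_i-m_{i-1})+1\Big).\] A set is an arithmetic progression with common difference $d$ if it has the form $\{a, a+d, \ldots, a+(n-1)d\}$. *)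

theory Defs
  imports Main
begin

text \<open>\<open>gen_sumset r h A\<close> is $h^{(r)}A$, and \<open>gen_sumset_family r H A\<close> is $H^{(r)}A$.\<close>

definition gen_sumset :: "nat \<Rightarrow> nat \<Rightarrow> int set \<Rightarrow> int set" where
  "gen_sumset r h A =
     {(\<Sum>a\<in>A. int (l a) * a) | l :: int \<Rightarrow> nat.
        (\<forall>a\<in>A. l a \<le> r) \<and> (\<Sum>a\<in>A. l a) = h}"

definition gen_sumset_family :: "nat \<Rightarrow> nat set \<Rightarrow> int set \<Rightarrow> int set" where
  "gen_sumset_family r H A = (\<Union>h\<in>H. gen_sumset r h A)"

text \<open>\<open>nth_elem H i\<close> is the \<open>i\<close>-th smallest element of \<open>H\<close> for \<open>1 \<le> i \<le> card H\<close>, preceded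
  by the value \<open>0\<close> at index \<open>0\<close>.\<close>

definition nth_elem :: "nat set \<Rightarrow> nat \<Rightarrow> nat" where
  "nth_elem H i = (0 # sorted_list_of_set H) ! i"

text \<open>The value lies in the integers: \<open>m i - m (i - 1)\<close> is nonnegative, but
  \<open>\<epsilon> i - \<epsilon> (i - 1)\<close> and \<open>k - m i - 1\<close> can be negative.\<close>

definition L_bound :: "int \<Rightarrow> nat set \<Rightarrow> nat \<Rightarrow> int" where
  "L_bound k H r =
     (let m = (\<lambda>i. int (nth_elem H i div r));
          \<epsilon> = (\<lambda>i. int (nth_elem H i mod r))
      in \<Sum>i = 1..card H.
           int r * (m i - m (i - 1)) * (k - m i)
           + (\<epsilon> i - \<epsilon> (i - 1)) * (k - m i - 1)
           - max (\<epsilon> i) (\<epsilon> (i - 1)) * (m i - m (i - 1))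
           + 1)"

definition is_arith_prog :: "'a::semiring_1 \<Rightarrow> 'a set \<Rightarrow> bool" where
  "is_arith_prog d S \<longleftrightarrow> (\<exists>a n. n \<ge> 1 \<and> S = {a + of_nat i * d | i. i < n})"

end

theory Submission
  imports Defs
begin

text \<open>
  Grade a coefficient vector \<open>l\<close> of level \<open>h\<^sub>i\<close> by \<open>\<Sum>n. n * l n\<close>, shifted by a constant
  depending on \<open>i\<close>. Moving one unit to an adjacent position changes the rank by one and
  the represented sum strictly; so does passing to the next level by adding the cheapest vector of
  total \<open>h\<^sub>i\<^sub>+\<^sub>1 - h\<^sub>i\<close> to the top vector of level \<open>h\<^sub>i\<close>, since the elements of \<open>A\<close> are positive.
  Hence every vector has a neighbour in both directions until the extreme ranks, and the
  number of ranks is at least \<open>L\<close>. If there are only \<open>L\<close> sums, then the sum is a function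
  of the rank. Comparing vectors of equal rank inside the last level shows that distant consecutive
  differences of \<open>A\<close> agree, so \<open>A\<close> is a progression with some difference \<open>\<delta>\<close>; comparing the
  top of level \<open>h\<^sub>i\<close> with a vector of level \<open>h\<^sub>i\<^sub>+\<^sub>1\<close> of the same rank shows that the cheapest vector
  of total \<open>h\<^sub>i\<^sub>+\<^sub>1 - h\<^sub>i\<close> has value \<open>\<delta>\<close>. This value would exceed \<open>\<delta>\<close> if the gap were larger
  than \<open>r\<close>, and otherwise it is \<open>(h\<^sub>i\<^sub>+\<^sub>1 - h\<^sub>i) * min A\<close>.
\<close>

section \<open>Counting the values of a graded set\<close>

text \<open>Descending from \<open>x\<close> gives at least \<open>\<rho> x\<close> values below
  \<open>v x\<close>, ascending at least \<open>N - 1 - \<rho> x\<close> above it. With at most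
  \<open>N\<close> values both bounds are attained, so the rank counts the values below and thereby
  fixes \<open>v x\<close>.\<close>

lemma rank_determines_value:
  fixes v \<rho> :: "'a \<Rightarrow> int"
  assumes fin: "finite (v ` C)" and N: "int (card (v ` C)) \<le> N"
    and down: "\<And>x. \<lbrakk>x \<in> C; \<rho> x > 0\<rbrakk> \<Longrightarrow> \<exists>y\<in>C. \<rho> y = \<rho> x - 1 \<and> v y < v x"
    and up: "\<And>x. \<lbrakk>x \<in> C; \<rho> x < N - 1\<rbrakk> \<Longrightarrow> \<exists>y\<in>C. \<rho> y = \<rho> x + 1 \<and> v x < v y"
    and xy: "x \<in> C" "y \<in> C" "\<rho> x = \<rho> y"
  shows "v x = v y"
proof -
  define S where "S = v ` C"
  have finS: "finite S" using fin by (simp add: S_def)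
  have below: "\<forall>x\<in>C. \<rho> x \<le> int n \<longrightarrow> \<rho> x \<le> int (card {s\<in>S. s < v x})" for n
  proof (induction n)
    case (Suc n)
    show ?case
    proof (intro ballI impI)
      fix x assume x: "x \<in> C" "\<rho> x \<le> int (Suc n)"
      show "\<rho> x \<le> int (card {s\<in>S. s < v x})"
      proof (cases "\<rho> x > 0")
        case True
        with down x obtain y where y: "y \<in> C" "\<rho> y = \<rho> x - 1" "v y < v x" by blast
        have "{s\<in>S. s < v y} \<subset> {s\<in>S. s < v x}" using y by (auto simp: S_def)
        then have "card {s\<in>S. s < v y} < card {s\<in>S. s < v x}"
          using finS by (intro psubset_card_mono) auto
        with Suc y x show ?thesis by fastforce
      qed auto
    qed
  qed auto
  have above: "\<forall>x\<in>C. N - 1 - \<rho> x \<le> int n \<longrightarrow>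
      N - 1 - \<rho> x \<le> int (card {s\<in>S. v x < s})" for n
  proof (induction n)
    case (Suc n)
    show ?case
    proof (intro ballI impI)
      fix x assume x: "x \<in> C" "N - 1 - \<rho> x \<le> int (Suc n)"
      show "N - 1 - \<rho> x \<le> int (card {s\<in>S. v x < s})"
      proof (cases "\<rho> x < N - 1")
        case True
        with up x obtain y where y: "y \<in> C" "\<rho> y = \<rho> x + 1" "v x < v y"
          by blast
        have "{s\<in>S. v y < s} \<subset> {s\<in>S. v x < s}" using y by (auto simp: S_def)
        then have "card {s\<in>S. v y < s} < card {s\<in>S. v x < s}"
          using finS by (intro psubset_card_mono) auto
        with Suc y x show ?thesis by fastforce
      qed auto
    qed
  qed auto
  have split: "card {s\<in>S. s < v x} + card {s\<in>S. v x < s} + 1 = card S" if "x \<in> C" for x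
  proof -
    have "S = insert (v x) ({s\<in>S. s < v x} \<union> {s\<in>S. v x < s})"
      using that by (auto simp: S_def)
    then have "card S = card (insert (v x) ({s\<in>S. s < v x} \<union> {s\<in>S. v x < s}))" by simp
    also have "\<dots> = Suc (card ({s\<in>S. s < v x} \<union> {s\<in>S. v x < s}))" using finS by simp
    also have "card ({s\<in>S. s < v x} \<union> {s\<in>S. v x < s}) = card {s\<in>S. s < v x} + card {s\<in>S. v x < s}"
      using finS by (intro card_Un_disjoint) auto
    finally show ?thesis by simp
  qed
  have pos: "int (card {s\<in>S. s < v x}) = \<rho> x" if "x \<in> C" for x
    using below[of "nat (\<rho> x)"] above[of "nat (N - 1 - \<rho> x)"] split[OF that] that N
    unfolding S_def[symmetric] by fastforce
  have less: "card {s\<in>S. s < v x} < card {s\<in>S. s < v y}" if "x \<in> C" "v x < v y" for x y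
    using finS that by (intro psubset_card_mono) (auto simp: S_def)
  show ?thesis
    using less[of x y] less[of y x] pos[of x] pos[of y] xy by (cases "v x" "v y" rule: linorder_cases) auto
qed

section \<open>Coefficient vectors and unit moves\<close>

text \<open>\<open>config k r h l\<close> says that \<open>l\<close> is an admissible coefficient vector \<open>(\<lambda>\<^sub>1, \<dots>, \<lambda>\<^sub>k)\<close>
  for \<open>h\<^sup>(\<^sup>r\<^sup>)A\<close>, indexed from \<open>0\<close>.\<close>

definition config :: "nat \<Rightarrow> nat \<Rightarrow> nat \<Rightarrow> (nat \<Rightarrow> nat) \<Rightarrow> bool" where
  "config k r h l \<longleftrightarrow> (\<forall>i<k. l i \<le> r) \<and> (\<Sum>i<k. l i) = h"

text \<open>The same functional gives the total (\<open>w\<close> constantly 1), the rank up to a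
  shift (\<open>w = int\<close>) and the represented sum (\<open>w = a\<close>).\<close>

definition weight :: "nat \<Rightarrow> (nat \<Rightarrow> int) \<Rightarrow> (nat \<Rightarrow> nat) \<Rightarrow> int" where
  "weight k w l = (\<Sum>i<k. w i * int (l i))"

text \<open>Greedy filling from the left: entries \<open>r\<close>, at most one partial entry, then
  zeros by truncated subtraction.\<close>

definition bottom :: "nat \<Rightarrow> nat \<Rightarrow> nat \<Rightarrow> nat" where
  "bottom r h i = min r (h - i * r)"

definition top_config :: "nat \<Rightarrow> nat \<Rightarrow> nat \<Rightarrow> nat \<Rightarrow> nat" where
  "top_config k r h i = bottom r h (k - 1 - i)"

definition move :: "nat \<Rightarrow> nat \<Rightarrow> (nat \<Rightarrow> nat) \<Rightarrow> nat \<Rightarrow> nat" where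
  "move i j l = l(i := l i - 1, j := l j + 1)"

lemma weight_move:
  assumes "i < k" "j < k" "i \<noteq> j" "l i \<ge> 1"
  shows "weight k w (move i j l) = weight k w l - w i + w j"
proof -
  have "weight k w (move i j l) = (\<Sum>n<k. w n * int (l n) + (if n = i then - w i else 0) + (if n = j then w j else 0))"
    unfolding weight_def move_def using assms
    by (intro sum.cong) (auto simp: algebra_simps of_nat_diff)
  also have "\<dots> = weight k w l - w i + w j"
    using assms by (simp add: weight_def sum.distrib sum.delta)
  finally show ?thesis .
qed

lemma config_weight: "config k r h l \<longleftrightarrow> (\<forall>i<k. l i \<le> r) \<and> weight k (\<lambda>_. 1) l = int h"
  by (simp add: config_def weight_def flip: of_nat_sum)

lemma config_move:
  assumes "config k r h l" "i < k" "j < k" "i \<noteq> j" "l i \<ge> 1" "l j < r"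
  shows "config k r h (move i j l)"
  using assms by (auto simp: config_weight weight_move) (auto simp: move_def)

lemma weight_add: "weight k w (\<lambda>i. l i + l' i) = weight k w l + weight k w l'"
  by (simp add: weight_def algebra_simps sum.distrib)

lemma weight_diff:
  assumes "\<And>i. i < k \<Longrightarrow> l' i \<le> l i"
  shows "weight k w (\<lambda>i. l i - l' i) = weight k w l - weight k w l'"
  unfolding weight_def using assms
  by (simp add: sum_subtractf[symmetric] of_nat_diff algebra_simps)

lemma weight_cong: "(\<And>i. i < k \<Longrightarrow> l i = l' i) \<Longrightarrow> weight k w l = weight k w l'"
  by (simp add: weight_def)

lemma weight_reflect: "weight k w (\<lambda>i. l (k - 1 - i)) = weight k (\<lambda>i. w (k - 1 - i)) l"
  unfolding weight_def
  by (rule sum.reindex_bij_witness[of _ "\<lambda>i. k - 1 - i" "\<lambda>i. k - 1 - i"]) auto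

lemma config_reflect: "config k r h (\<lambda>i. l (k - 1 - i)) \<longleftrightarrow> config k r h l"
proof -
  have "(\<forall>i<k. l (k - 1 - i) \<le> r) \<longleftrightarrow> (\<forall>i<k. l i \<le> r)"
  proof safe
    fix i assume "\<forall>i<k. l (k - 1 - i) \<le> r" "i < k"
    then show "l i \<le> r" by (auto dest: spec[of _ "k - 1 - i"])
  qed auto
  then show ?thesis using weight_reflect[of k "\<lambda>_. 1" l] by (simp only: config_weight)
qed

lemma sum_bottom: "(\<Sum>i<n. bottom r h i) = min h (n * r)"
  by (induction n) (auto simp: bottom_def min_def)

lemma config_bottom: "h \<le> k * r \<Longrightarrow> config k r h (bottom r h)"
  by (simp add: config_def sum_bottom) (simp add: bottom_def)

lemma config_top: "h \<le> k * r \<Longrightarrow> config k r h (top_config k r h)"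
  unfolding top_config_def by (subst config_reflect) (rule config_bottom)

text \<open>An entry below \<open>r\<close> forces zeros after it, since otherwise some unit could
  move left. Hence every prefix sum is \<open>min h (n * r)\<close>, and prefix sums determine the
  entries.\<close>

lemma no_down_step_imp_bottom:
  assumes c: "config k r h l" and r: "r \<ge> 1"
    and stuck: "\<And>i. \<lbrakk>Suc i < k; l (Suc i) \<ge> 1\<rbrakk> \<Longrightarrow> l i \<ge> r"
    and i: "i < k"
  shows "l i = bottom r h i"
proof -
  have zero: "l j = 0" if "n < j" "j < k" "l n < r" for n j
    using that
  proof (induction j)
    case (Suc j)
    have "l j < r" using Suc r by (cases "j = n") auto
    with stuck[of j] Suc.prems show ?case by (cases "l (Suc j)") auto
  qed simp
  have prefix: "(\<Sum>j<n. l j) = min h (n * r)" if "n \<le> k" for n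
    using that
  proof (induction n)
    case (Suc n)
    have le: "l n \<le> r" using c Suc.prems by (auto simp: config_def)
    have tot: "(\<Sum>j<Suc n. l j) \<le> h"
      using c Suc.prems sum_mono2[of "{..<k}" "{..<Suc n}" l] by (auto simp: config_def)
    have IH: "(\<Sum>j<n. l j) = min h (n * r)" using Suc by simp
    show ?case
    proof (cases "l n < r")
      case True
      have "(\<Sum>j<Suc n. l j) = (\<Sum>j<k. l j)"
        using Suc.prems zero[OF _ _ True] by (intro sum.mono_neutral_left) auto
      then have "(\<Sum>j<Suc n. l j) = h" using c by (simp add: config_def)
      with IH True show ?thesis by (auto simp: min_def split: if_splits)
    next
      case False
      with le IH tot show ?thesis by (auto simp: min_def)
    qed
  qed simp
  have "(\<Sum>j<Suc i. l j) = min h (Suc i * r)" "(\<Sum>j<i. l j) = min h (i * r)"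
    using prefix[of i] prefix[of "Suc i"] i by simp_all
  then show ?thesis by (auto simp: bottom_def min_def split: if_splits)
qed

lemma down_step:
  assumes "config k r h l" "r \<ge> 1" "i < k" "l i \<noteq> bottom r h i"
  obtains j where "Suc j < k" "config k r h (move (Suc j) j l)"
    "\<And>w. weight k w (move (Suc j) j l) = weight k w l - w (Suc j) + w j"
proof -
  obtain j where "Suc j < k" "l (Suc j) \<ge> 1" "l j < r"
    using no_down_step_imp_bottom[of k r h l i] assms by (meson linorder_not_le)
  then show ?thesis using that config_move weight_move assms(1) by simp
qed

text \<open>A leftward move of the reversed vector is a rightward move of \<open>l\<close>.\<close>

lemma up_step:
  assumes "config k r h l" "r \<ge> 1" "i < k" "l i \<noteq> top_config k r h i"
  obtains j where "Suc j < k" "config k r h (move j (Suc j) l)"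
    "\<And>w. weight k w (move j (Suc j) l) = weight k w l - w j + w (Suc j)"
proof -
  have "config k r h (\<lambda>i. l (k - 1 - i))" using assms config_reflect by blast
  moreover have "l (k - 1 - (k - 1 - i)) \<noteq> bottom r h (k - 1 - i)"
    using assms by (simp add: top_config_def)
  ultimately have "\<not> (\<forall>j. Suc j < k \<longrightarrow> l (k - 1 - Suc j) \<ge> 1 \<longrightarrow> l (k - 1 - j) \<ge> r)"
    using no_down_step_imp_bottom[of k r h "\<lambda>i. l (k - 1 - i)" "k - 1 - i"] assms(2,3) by auto
  then obtain j where j: "Suc j < k" "l (k - 1 - Suc j) \<ge> 1" "l (k - 1 - j) < r"
    by (auto simp: not_le)
  define n where "n = k - 1 - Suc j"
  have "k - 1 - j = Suc n" "Suc n < k" using j by (auto simp: n_def)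
  with j have n: "Suc n < k" "l n \<ge> 1" "l (Suc n) < r" by (auto simp: n_def)
  show ?thesis
    by (rule that[of n]) (use n assms(1) in \<open>auto intro: config_move simp: weight_move\<close>)
qed

section \<open>Extreme ranks and the summands of \<open>L_bound\<close>\<close>

lemma double_sum_int: "2 * (\<Sum>i<n. int i) = int n * (int n - 1)"
  by (induction n) (auto simp: algebra_simps)

text \<open>Positions below \<open>h div r\<close> are full and the next one holds
  \<open>h mod r\<close>; doubling avoids halving a triangular number.\<close>

lemma weight_bottom:
  assumes "r \<ge> 1" "h < k * r"
  shows "2 * weight k int (bottom r h) =
    int r * int (h div r) * (int (h div r) - 1) + 2 * int (h mod r) * int (h div r)"
proof -
  define m where "m = h div r"
  have h: "h = m * r + h mod r" "h mod r < r" using assms by (auto simp: m_def)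
  have "m < k" using assms by (simp add: m_def less_mult_imp_div_less)
  have full: "bottom r h i = r" if "i < m" for i
  proof -
    have "Suc i * r \<le> m * r" using that by (intro mult_right_mono) auto
    with h show ?thesis by (auto simp: bottom_def)
  qed
  have part: "bottom r h m = h mod r"
    using h by (metis bottom_def diff_add_inverse min.absorb4)
  have empty: "bottom r h i = 0" if "m < i" for i
  proof -
    have "Suc m * r \<le> i * r" using that by (intro mult_right_mono) auto
    with h show ?thesis by (auto simp: bottom_def)
  qed
  have "weight k int (bottom r h) = (\<Sum>i<Suc m. int i * int (bottom r h i))"
    unfolding weight_def using \<open>m < k\<close> empty
    by (intro sum.mono_neutral_right) auto
  also have "\<dots> = int r * (\<Sum>i<m. int i) + int m * int (h mod r)"
    using full part by (simp add: sum_distrib_left mult.commute)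
  finally have "2 * weight k int (bottom r h) = int r * (2 * (\<Sum>i<m. int i)) + 2 * int m * int (h mod r)"
    by simp
  then show ?thesis unfolding double_sum_int by (simp add: m_def)
qed

lemma weight_top:
  assumes "h \<le> k * r"
  shows "weight k int (top_config k r h) = (int k - 1) * int h - weight k int (bottom r h)"
proof -
  have "weight k int (top_config k r h) = weight k (\<lambda>i. int (k - 1 - i)) (bottom r h)"
    using weight_reflect[of k int "bottom r h"] by (simp add: top_config_def[abs_def])
  also have "\<dots> = (\<Sum>i<k. (int k - 1) * int (bottom r h i) - int i * int (bottom r h i))"
    unfolding weight_def by (intro sum.cong) (auto simp: of_nat_diff algebra_simps)
  also have "\<dots> = (int k - 1) * int (\<Sum>i<k. bottom r h i) - weight k int (bottom r h)"
    by (simp add: sum_subtractf weight_def sum_distrib_left)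
  finally show ?thesis using assms by (simp add: sum_bottom)
qed

text \<open>The inequality is strict if \<open>e < e'\<close> and \<open>m - m' \<ge> 2\<close>: the summand of \<open>L_bound\<close> is then not
  the sharp one.\<close>

lemma L_bound_summand:
  assumes r: "r \<ge> 1" and h: "h' < h" "h < k * r"
  defines "m \<equiv> int (h div r)" and "m' \<equiv> int (h' div r)"
    and "e \<equiv> int (h mod r)" and "e' \<equiv> int (h' mod r)"
  shows "int r * (m - m') * (int k - m) + (e - e') * (int k - m - 1) - max e e' * (m - m') \<le>
    weight k int (top_config k r h) - weight k int (top_config k r h') - weight k int (bottom r (h - h'))"
proof -
  define R where "R = int r"
  have eqs: "int h = m * R + e" "int h' = m' * R + e'"
    by (simp_all add: m_def m'_def e_def e'_def R_def flip: of_nat_mult of_nat_add)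
  have bnd: "0 \<le> e" "e < R" "0 \<le> e'" "e' < R"
    using r by (auto simp: e_def e'_def R_def)
  have T: "2 * weight k int (top_config k r h) = 2 * (int k - 1) * int h - (R * m * (m - 1) + 2 * e * m)"
    "2 * weight k int (top_config k r h') = 2 * (int k - 1) * int h' - (R * m' * (m' - 1) + 2 * e' * m')"
    using weight_top[of h k r] weight_top[of h' k r] weight_bottom[of r h k] weight_bottom[of r h' k] r h
    by (simp_all add: m_def m'_def e_def e'_def R_def algebra_simps)
  define q f where "q = int ((h - h') div r)" and "f = int ((h - h') mod r)"
  have B: "2 * weight k int (bottom r (h - h')) = R * q * (q - 1) + 2 * f * q"
    using weight_bottom[of r "h - h'" k] r h by (simp add: q_def f_def R_def)
  have qf: "q * R + f = (m - m') * R + (e - e')" "0 \<le> f" "f < R"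
  proof -
    have "int (h - h') = q * R + f"
      by (simp add: q_def f_def R_def flip: of_nat_mult of_nat_add)
    then show "q * R + f = (m - m') * R + (e - e')" using eqs h by (simp add: of_nat_diff algebra_simps)
    show "0 \<le> f" "f < R" using r by (auto simp: f_def R_def)
  qed
  have quot: "n * R + u = n' * R + u' \<Longrightarrow> n = n'" if "0 \<le> u" "u < R" "0 \<le> u'" "u' < R" for n n' u u'
  proof -
    assume "n * R + u = n' * R + u'"
    then have "(n * R + u) div R = (n' * R + u') div R" by simp
    then show "n = n'" using that by (simp add: div_pos_pos_trivial)
  qed
  have "2 * (R * (m - m') * (int k - m) + (e - e') * (int k - m - 1) - max e e' * (m - m')) \<le>
    2 * (weight k int (top_config k r h) - weight k int (top_config k r h') - weight k int (bottom r (h - h')))"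
  \<comment> \<open>Without a borrow in the subtraction of \<open>h'\<close> from \<open>h\<close>,
    both sides agree; a borrow lowers the quotient by one.\<close>
  proof (cases "e' \<le> e")
    case True
    have q: "q = m - m'"
      using quot[OF _ _ _ _ qf(1)] qf bnd True by simp
    have f: "f = e - e'" using qf q by simp
    have mx: "max e e' = e" using True by simp
    show ?thesis
      unfolding right_diff_distrib T B eqs mx f q by (simp add: algebra_simps)
  next
    case False
    have "q * R + f = (m - m' - 1) * R + (R + e - e')" using qf by (simp add: algebra_simps)
    then have q: "q = m - m' - 1"
      by (rule quot[rotated -1]) (use qf bnd False in auto)
    have f: "f = R + e - e'" using qf(1) unfolding q by (simp add: algebra_simps)
    have mx: "max e e' = e'" using False by simp
    have "m' < m"
    proof (rule ccontr)
      assume "\<not> m' < m"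
      then have "m * R \<le> m' * R" using bnd by (intro mult_right_mono) auto
      with eqs h False show False by linarith
    qed
    \<comment> \<open>This product is exactly the difference of the two sides before
      doubling.\<close>
    then have "(e' - e) * (m - m' - 1) \<ge> 0" using False by simp
    then show ?thesis
      unfolding right_diff_distrib T B eqs mx f q by (simp add: algebra_simps)
  qed
  then show ?thesis by (simp add: R_def)
qed

section \<open>Vectors under entrywise constraints\<close>

text \<open>Discrete intermediate values: start from \<open>b\<close> and raise one unsaturated
  entry at a time.\<close>

lemma exists_between_with_sum:
  fixes b c :: "nat \<Rightarrow> nat"
  assumes "\<forall>i<k. b i \<le> c i" "(\<Sum>i<k. b i) \<le> h" "h \<le> (\<Sum>i<k. c i)"
  shows "\<exists>l. (\<forall>i<k. b i \<le> l i \<and> l i \<le> c i) \<and> (\<Sum>i<k. l i) = h"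
  using assms(2,3)
proof (induction h rule: dec_induct)
  case base
  then show ?case using assms(1) by blast
next
  case (step n)
  then obtain l where l: "\<forall>i<k. b i \<le> l i \<and> l i \<le> c i" "(\<Sum>i<k. l i) = n" by auto
  have "\<exists>j<k. l j < c j"
  proof (rule ccontr)
    assume "\<not> (\<exists>j<k. l j < c j)"
    then have "(\<Sum>i<k. c i) \<le> (\<Sum>i<k. l i)" by (intro sum_mono) (meson lessThan_iff not_less)
    with l step show False by simp
  qed
  then obtain j where j: "j < k" "l j < c j" by blast
  have "(\<Sum>i<k. (l(j := Suc (l j))) i) = (\<Sum>i<k. l i + (if i = j then 1 else 0))"
    by (intro sum.cong) auto
  then have "(\<Sum>i<k. (l(j := Suc (l j))) i) = Suc n"
    using l j by (simp add: sum.distrib)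
  moreover have "\<forall>i<k. b i \<le> (l(j := Suc (l j))) i \<and> (l(j := Suc (l j))) i \<le> c i"
    using l(1) j by (auto intro: le_SucI)
  ultimately show ?case by blast
qed

text \<open>The vector admits a unit move from \<open>Suc i\<close> to \<open>i\<close> together
  with one from \<open>j\<close> to \<open>Suc j\<close>; the four positions are distinct by
  \<open>i + 2 \<le> j\<close>.\<close>

lemma exists_exchangeable_config:
  assumes "r \<ge> 1" "2 \<le> h" "h + 2 \<le> k * r" "i + 2 \<le> j" "Suc j < k"
  shows "\<exists>l. config k r h l \<and> l i < r \<and> l (Suc i) \<ge> 1 \<and> l j \<ge> 1 \<and> l (Suc j) < r"
proof -
  \<comment> \<open>\<open>b\<close> reserves a unit where one will be removed, \<open>b'\<close> a
    free slot where one will be added.\<close>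
  define b where "b n = (if n = Suc i then 1 else 0) + (if n = j then 1 else (0::nat))" for n
  define b' where "b' n = (if n = i then 1 else 0) + (if n = Suc j then 1 else (0::nat))" for n
  have sums: "(\<Sum>n<k. b n) = 2" "(\<Sum>n<k. b' n) = 2"
    using assms by (simp_all add: b_def b'_def sum.distrib)
  have le: "b' n \<le> r" "b n \<le> r - b' n" for n
    using assms by (auto simp: b_def b'_def)
  have "(\<Sum>n<k. r - b' n) = k * r - 2"
    using sum_subtractf_nat[of "{..<k}" b' "\<lambda>_. r"] le sums by simp
  then have "h \<le> (\<Sum>n<k. r - b' n)" using assms by linarith
  then obtain l where l: "\<forall>n<k. b n \<le> l n \<and> l n \<le> r - b' n" "(\<Sum>n<k. l n) = h"
    using exists_between_with_sum[of k b "\<lambda>n. r - b' n" h] assms(2) le sums by auto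
  have "l i \<le> r - b' i" "b (Suc i) \<le> l (Suc i)" "b j \<le> l j" "l (Suc j) \<le> r - b' (Suc j)"
    using l assms by simp_all
  then have "l i < r \<and> l (Suc i) \<ge> 1 \<and> l j \<ge> 1 \<and> l (Suc j) < r"
    using assms by (auto simp: b_def b'_def)
  moreover have "config k r h l" using l by (auto simp: config_def intro: le_trans[OF _ diff_le_self])
  ultimately show ?thesis by blast
qed

text \<open>The top vector uses position \<open>n\<close> only if
  \<open>h > (k - 1 - n) * r\<close>, the bottom vector only if \<open>d > n * r\<close>; both
  together contradict the assumption.\<close>

lemma config_top_add_bottom:
  assumes "h + d < (k - 1) * r"
  shows "config k r (h + d) (\<lambda>n. top_config k r h n + bottom r d n)"
proof -
  have hd: "h \<le> k * r" "d \<le> k * r"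
    using assms by (auto simp: diff_mult_distrib)
  have "top_config k r h n + bottom r d n \<le> r" if "n < k" for n
  proof -
    have "(k - 1 - n) * r + n * r = (k - 1) * r" using that by (simp flip: distrib_right)
    then have "h \<le> (k - 1 - n) * r \<or> d \<le> n * r" using assms by linarith
    then show ?thesis by (auto simp: top_config_def bottom_def)
  qed
  then show ?thesis
    using config_top[OF hd(1)] config_bottom[OF hd(2)] by (simp add: config_def sum.distrib)
qed

lemma weight_bottom_pos:
  assumes "\<And>i. i < k \<Longrightarrow> 0 < w i" "0 < k" "1 \<le> r" "0 < d"
  shows "0 < weight k w (bottom r d)"
  unfolding weight_def
  by (rule sum_pos2[of _ 0]) (use assms in \<open>auto simp: bottom_def less_imp_le\<close>)

section \<open>The graded chain of levels\<close>

locale sumset_chain =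
  fixes r k t :: nat and a :: "nat \<Rightarrow> int" and h :: "nat \<Rightarrow> nat"
  assumes r_pos: "1 \<le> r" and k_ge: "5 \<le> k" and t_ge: "2 \<le> t"
    and a_mono: "\<And>i j. \<lbrakk>i < j; j < k\<rbrakk> \<Longrightarrow> a i < a j" and a_pos: "\<And>i. i < k \<Longrightarrow> 0 < a i"
    and h_0: "h 0 = 0" and h_Suc: "\<And>i. i < t \<Longrightarrow> h i < h (Suc i)"
    and h_max: "h t < (k - 1) * r"
begin

definition configs :: "(nat \<times> (nat \<Rightarrow> nat)) set" where
  "configs = {(i, l). 1 \<le> i \<and> i \<le> t \<and> config k r (h i) l}"

definition gap :: "nat \<Rightarrow> nat" where
  "gap i = h i - h (i - 1)"

text \<open>The shift gives the greedy vector of level 1 rank 0, and makes adding the greedy vector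
  of the next gap raise the rank by exactly one.\<close>

definition rank :: "nat \<times> (nat \<Rightarrow> nat) \<Rightarrow> int" where
  "rank x = weight k int (snd x) - (\<Sum>j = 1..fst x. weight k int (bottom r (gap j))) + int (fst x) - 1"

definition val :: "nat \<times> (nat \<Rightarrow> nat) \<Rightarrow> int" where
  "val x = weight k a (snd x)"

text \<open>This telescopes to one more than the rank of the top vector of level \<open>t\<close>;
  the sum over levels permits termwise comparison with \<open>L_bound\<close>.\<close>

definition chain_length :: int where
  "chain_length = (\<Sum>j = 1..t. weight k int (top_config k r (h j)) - weight k int (top_config k r (h (j - 1)))
     - weight k int (bottom r (gap j)) + 1)"

lemma h_le: "i \<le> j \<Longrightarrow> j \<le> t \<Longrightarrow> h i \<le> h j"
proof (induction j rule: dec_induct)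
  case (step n)
  then show ?case using h_Suc[of n] by simp
qed simp

lemma h_ge: "i \<le> t \<Longrightarrow> i \<le> h i"
proof (induction i)
  case (Suc i)
  then show ?case using h_Suc[of i] by simp
qed simp

lemma h_bounds: "i \<le> t \<Longrightarrow> h i < (k - 1) * r" "i \<le> t \<Longrightarrow> h i \<le> k * r"
  using h_le[of i t] h_max by (auto simp: diff_mult_distrib)

lemma gap_Suc: "i < t \<Longrightarrow> h (Suc i) = h i + gap (Suc i)" "i < t \<Longrightarrow> 0 < gap (Suc i)"
  using h_Suc[of i] by (simp_all add: gap_def)

lemma chain_length_eq:
  "chain_length = weight k int (top_config k r (h t)) - (\<Sum>j = 1..t. weight k int (bottom r (gap j))) + int t"
proof -
  have telescope: "(\<Sum>j = 1..n. f j - f (j - 1) - g j + 1) = f n - f 0 - (\<Sum>j = 1..n. g j) + int n"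
    for f g :: "nat \<Rightarrow> int" and n
    by (induction n) auto
  have "weight k int (top_config k r (h 0)) = 0"
    by (simp add: weight_def top_config_def bottom_def h_0)
  then show ?thesis
    unfolding chain_length_def
    using telescope[of "\<lambda>j. weight k int (top_config k r (h j))" "\<lambda>j. weight k int (bottom r (gap j))" t]
    by simp
qed

text \<open>The greedy vector \<open>bottom r (h i)\<close> contains the greedy vector of the \<open>i\<close>-th gap; removing the
  latter leads down to level \<open>i - 1\<close>.\<close>

lemma exists_predecessor:
  assumes "x \<in> configs" "0 < rank x"
  shows "\<exists>y\<in>configs. rank y = rank x - 1 \<and> val y < val x"
proof -
  obtain i l where x: "x = (i, l)" by (cases x)
  have i: "1 \<le> i" "i \<le> t" and l: "config k r (h i) l" using assms x by (auto simp: configs_def)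
  show ?thesis
  proof (cases "\<exists>n<k. l n \<noteq> bottom r (h i) n")
    case True
    then obtain j where j: "Suc j < k" "config k r (h i) (move (Suc j) j l)"
      "\<And>w. weight k w (move (Suc j) j l) = weight k w l - w (Suc j) + w j"
      using down_step[OF l r_pos] by blast
    then have "(i, move (Suc j) j l) \<in> configs" using i by (simp add: configs_def)
    moreover have "rank (i, move (Suc j) j l) = rank x - 1"
      using j(3)[of int] by (simp add: rank_def x)
    moreover have "val (i, move (Suc j) j l) < val x"
      using j(3)[of a] a_mono[of j "Suc j"] j(1) by (simp add: val_def x)
    ultimately show ?thesis by blast
  next
    case False
    then have w: "weight k w l = weight k w (bottom r (h i))" for w
      by (intro weight_cong) auto
    obtain i' where i': "i = Suc i'" using i by (cases i) auto
    \<comment> \<open>On level 1 the first gap is \<open>h 1\<close> itself, so the greedy vector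
      there has rank 0.\<close>
    have "i' \<noteq> 0"
      using assms(2) w[of int] h_0 by (intro notI) (simp add: rank_def x i' gap_def)
    define l' where "l' n = bottom r (h i) n - bottom r (gap i) n" for n
    have le: "bottom r (gap i) n \<le> bottom r (h i) n" for n
      by (auto simp: bottom_def gap_def min_def)
    have w': "weight k w l' = weight k w l - weight k w (bottom r (gap i))" for w
      unfolding w l'_def[abs_def] by (intro weight_diff le)
    have "config k r (h i') l'"
    proof -
      have "gap i \<le> k * r" using h_bounds(2)[of i] i by (auto simp: gap_def)
      then have "config k r (gap i) (bottom r (gap i))" by (rule config_bottom)
      then have "weight k (\<lambda>_. 1) l' = int (h i')"
        using w'[of "\<lambda>_. 1"] l gap_Suc(1)[of i'] i i' by (simp add: config_weight)
      moreover have "l' n \<le> r" for n by (auto simp: l'_def bottom_def)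
      ultimately show ?thesis by (simp add: config_weight)
    qed
    then have "(i', l') \<in> configs" using i i' \<open>i' \<noteq> 0\<close> by (simp add: configs_def)
    moreover have "rank (i', l') = rank x - 1"
      using w'[of int] i' by (simp add: rank_def x)
    moreover have "val (i', l') < val x"
      using w'[of a] weight_bottom_pos[of k a r "gap i"] a_pos r_pos k_ge gap_Suc(2)[of i'] i i'
      by (simp add: val_def x)
    ultimately show ?thesis by blast
  qed
qed

text \<open>As \<open>h t < (k - 1) * r\<close>, the top vector of level \<open>i\<close> and the greedy bottom vector of the next gap
  never use the same position, so their sum is admissible on level \<open>i + 1\<close>.\<close>

lemma exists_successor:
  assumes "x \<in> configs" "rank x < chain_length - 1"
  shows "\<exists>y\<in>configs. rank y = rank x + 1 \<and> val x < val y"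
proof -
  obtain i l where x: "x = (i, l)" by (cases x)
  have i: "1 \<le> i" "i \<le> t" and l: "config k r (h i) l" using assms x by (auto simp: configs_def)
  show ?thesis
  proof (cases "\<exists>n<k. l n \<noteq> top_config k r (h i) n")
    case True
    then obtain j where j: "Suc j < k" "config k r (h i) (move j (Suc j) l)"
      "\<And>w. weight k w (move j (Suc j) l) = weight k w l - w j + w (Suc j)"
      using up_step[OF l r_pos] by blast
    then have "(i, move j (Suc j) l) \<in> configs" using i by (simp add: configs_def)
    moreover have "rank (i, move j (Suc j) l) = rank x + 1"
      using j(3)[of int] by (simp add: rank_def x)
    moreover have "val x < val (i, move j (Suc j) l)"
      using j(3)[of a] a_mono[of j "Suc j"] j(1) by (simp add: val_def x)
    ultimately show ?thesis by blast
  next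
    case False
    then have w: "weight k w l = weight k w (top_config k r (h i))" for w
      by (intro weight_cong) auto
    \<comment> \<open>The top vector of level \<open>t\<close> has rank
      \<open>chain_length - 1\<close>.\<close>
    have "i \<noteq> t"
      using assms(2) w[of int] by (auto simp: rank_def x chain_length_eq)
    then have "i < t" using i by simp
    define l' where "l' n = top_config k r (h i) n + bottom r (gap (Suc i)) n" for n
    have w': "weight k w l' = weight k w l + weight k w (bottom r (gap (Suc i)))" for w
      unfolding w l'_def[abs_def] by (rule weight_add)
    have "config k r (h (Suc i)) l'"
      using config_top_add_bottom[of "h i" "gap (Suc i)" k r] h_bounds(1)[of "Suc i"] gap_Suc(1)[of i] \<open>i < t\<close>
      by (simp add: l'_def[abs_def])
    then have "(Suc i, l') \<in> configs" using \<open>i < t\<close> by (simp add: configs_def)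
    moreover have "rank (Suc i, l') = rank x + 1"
      using w'[of int] by (simp add: rank_def x)
    moreover have "val x < val (Suc i, l')"
      using w'[of a] weight_bottom_pos[of k a r "gap (Suc i)"] a_pos r_pos k_ge gap_Suc(2)[of i] \<open>i < t\<close>
      by (simp add: val_def x)
    ultimately show ?thesis by blast
  qed
qed

text \<open>\<open>configs\<close> itself is infinite, as entries from position \<open>k\<close> on
  are free; only the values are bounded.\<close>

lemma finite_values: "finite (val ` configs)"
proof (rule finite_subset)
  show "val ` configs \<subseteq> {0..weight k a (\<lambda>_. r)}"
  proof
    fix s assume "s \<in> val ` configs"
    then obtain i l where l: "config k r (h i) l" "s = weight k a l"
      by (auto simp: configs_def val_def)
    have "0 \<le> a n * int (l n)" "a n * int (l n) \<le> a n * int r" if "n < k" for n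
      using l a_pos[OF that] that by (auto simp: config_def intro!: mult_left_mono)
    then show "s \<in> {0..weight k a (\<lambda>_. r)}"
      unfolding l(2) weight_def by (auto intro!: sum_nonneg sum_mono)
  qed
qed simp

end

section \<open>The extremal case\<close>

locale extremal_sumset_chain = sumset_chain +
  assumes card_values: "int (card (val ` configs)) \<le> chain_length"
begin

lemma val_eq_of_rank_eq: "\<lbrakk>x \<in> configs; y \<in> configs; rank x = rank y\<rbrakk> \<Longrightarrow> val x = val y"
  by (rule rank_determines_value[OF finite_values card_values exists_predecessor exists_successor])

text \<open>Moving one unit from \<open>Suc i\<close> to \<open>i\<close> and one from
  \<open>j\<close> to \<open>Suc j\<close> preserves the rank, hence the sum.\<close>

lemma step_eq_distant:
  assumes "i + 2 \<le> j" "Suc j < k"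
  shows "a (Suc i) - a i = a (Suc j) - a j"
proof -
  have "2 \<le> h t" using h_ge[of t] t_ge by simp
  moreover have "h t + 2 \<le> k * r"
    using h_max r_pos by (auto simp: diff_mult_distrib)
  ultimately obtain l where l: "config k r (h t) l" "l i < r" "l (Suc i) \<ge> 1" "l j \<ge> 1" "l (Suc j) < r"
    using exists_exchangeable_config[OF r_pos _ _ assms] by blast
  define l' where "l' = move (Suc i) i l"
  have l': "config k r (h t) l'" "\<And>w. weight k w l' = weight k w l - w (Suc i) + w i"
    unfolding l'_def using l assms by (auto intro: config_move simp: weight_move)
  have "l' j = l j" "l' (Suc j) = l (Suc j)" using assms by (auto simp: l'_def move_def)
  then have l'': "config k r (h t) (move j (Suc j) l')"
    "\<And>w. weight k w (move j (Suc j) l') = weight k w l' - w j + w (Suc j)"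
    using l l' assms by (auto intro: config_move simp: weight_move)
  have "val (t, l) = val (t, move j (Suc j) l')"
    using l l' l'' t_ge by (intro val_eq_of_rank_eq) (auto simp: configs_def rank_def)
  then show ?thesis using l'(2)[of a] l''(2)[of a] by (simp add: val_def)
qed

lemma step_eq:
  assumes "Suc i < k"
  shows "a (Suc i) - a i = a 1 - a 0"
proof -
  consider "i = 0" | "i = 1" | "i \<ge> 2" by linarith
  then show ?thesis
  proof cases
    \<comment> \<open>Steps 0 and 1 are too close to compare directly; both are compared with step
      3, which exists by \<open>5 \<le> k\<close>.\<close>
    case 2
    then show ?thesis using step_eq_distant[of 1 3] step_eq_distant[of 0 3] k_ge by simp
  qed (use step_eq_distant[of 0 i] assms in auto)
qed

lemma weight_bottom_gap:
  assumes "1 \<le> i" "i < t"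
  shows "weight k a (bottom r (gap (Suc i))) = a 1 - a 0"
proof -
  define l where "l n = top_config k r (h i) n + bottom r (gap (Suc i)) n" for n
  have w: "weight k w l = weight k w (top_config k r (h i)) + weight k w (bottom r (gap (Suc i)))" for w
    unfolding l_def[abs_def] by (rule weight_add)
  have l: "config k r (h (Suc i)) l"
    using config_top_add_bottom[of "h i" "gap (Suc i)" k r] h_bounds(1)[of "Suc i"] gap_Suc(1)[of i] assms
    by (simp add: l_def[abs_def])
  \<comment> \<open>The last position is occupied in \<open>l\<close> but empty in the greedy
    vector, so \<open>l\<close> can move down, to the rank of the top vector of level
    \<open>i\<close>.\<close>
  have "l (k - 1) \<noteq> bottom r (h (Suc i)) (k - 1)"
    using h_bounds(1)[of "Suc i"] h_ge[of i] r_pos assms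
    by (auto simp: l_def top_config_def bottom_def)
  then obtain j where j: "Suc j < k" "config k r (h (Suc i)) (move (Suc j) j l)"
    "\<And>w. weight k w (move (Suc j) j l) = weight k w l - w (Suc j) + w j"
    using down_step[OF l r_pos, of "k - 1"] k_ge by auto
  have "config k r (h i) (top_config k r (h i))"
    using config_top h_bounds(2) assms by simp
  then have "val (i, top_config k r (h i)) = val (Suc i, move (Suc j) j l)"
    using j(2) j(3)[of int] w[of int] assms
    by (intro val_eq_of_rank_eq) (auto simp: configs_def rank_def)
  then show ?thesis using j(3)[of a] w[of a] step_eq[OF j(1)] by (simp add: val_def)
qed

text \<open>A larger gap would occupy positions 0 and 1, giving value at least
  \<open>a 0 + a 1\<close>, which exceeds \<open>a 1 - a 0\<close>.\<close>

lemma gap_le: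
  assumes "1 \<le> i" "i < t"
  shows "gap (Suc i) \<le> r"
proof (rule ccontr)
  assume "\<not> gap (Suc i) \<le> r"
  then have b: "bottom r (gap (Suc i)) 0 \<ge> 1" "bottom r (gap (Suc i)) 1 \<ge> 1"
    using r_pos by (auto simp: bottom_def)
  have "(\<Sum>n\<in>{0, 1}. a n * int (bottom r (gap (Suc i)) n)) \<le> weight k a (bottom r (gap (Suc i)))"
    unfolding weight_def using a_pos k_ge by (intro sum_mono2) (auto simp: less_imp_le)
  moreover have "a 0 * 1 \<le> a 0 * int (bottom r (gap (Suc i)) 0)" "a 1 * 1 \<le> a 1 * int (bottom r (gap (Suc i)) 1)"
    using b a_pos[of 0] a_pos[of 1] k_ge by (auto intro!: mult_left_mono simp del: mult_1_right)
  ultimately have "a 0 + a 1 \<le> a 1 - a 0"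
    using weight_bottom_gap[OF assms] by simp
  then show False using a_pos[of 0] k_ge by simp
qed

lemma gap_mult:
  assumes "1 \<le> i" "i < t"
  shows "int (gap (Suc i)) * a 0 = a 1 - a 0"
proof -
  have "bottom r (gap (Suc i)) = (\<lambda>n. if n = 0 then gap (Suc i) else 0)"
  proof
    fix n show "bottom r (gap (Suc i)) n = (if n = 0 then gap (Suc i) else 0)"
      using gap_le[OF assms] by (cases n) (auto simp: bottom_def)
  qed
  then have "weight k a (bottom r (gap (Suc i))) = (\<Sum>n<k. if n = 0 then int (gap (Suc i)) * a 0 else 0)"
    unfolding weight_def by (intro sum.cong) auto
  then show ?thesis using weight_bottom_gap[OF assms] k_ge by (simp add: sum.delta)
qed

lemma progressions:
  obtains d where "1 \<le> d" "d \<le> r" "\<And>i. i < t \<Longrightarrow> h (Suc i) = h 1 + i * d"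
    "\<And>i. i < k \<Longrightarrow> a i = a 0 + int i * (int d * a 0)"
proof
  \<comment> \<open>\<open>gap 1\<close> is measured from the artificial \<open>h 0 = 0\<close>;
    \<open>gap 2\<close> is the first difference inside the set of levels.\<close>
  define d where "d = gap 2"
  have d: "int d * a 0 = a 1 - a 0" using gap_mult[of 1] t_ge by (simp add: d_def numeral_2_eq_2)
  show "1 \<le> d" using gap_Suc(2)[of 1] t_ge by (simp add: d_def numeral_2_eq_2)
  show "d \<le> r" using gap_le[of 1] t_ge by (simp add: d_def numeral_2_eq_2)
  have gap: "gap (Suc i) = d" if "1 \<le> i" "i < t" for i
  proof -
    have "int (gap (Suc i)) * a 0 = int d * a 0" using gap_mult[OF that] d by simp
    then show ?thesis using a_pos[of 0] k_ge by simp
  qed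
  show "h (Suc i) = h 1 + i * d" if "i < t" for i
    using that
  proof (induction i)
    case (Suc i)
    then show ?case using gap_Suc(1)[of "Suc i"] gap[of "Suc i"] by simp
  qed simp
  show "a i = a 0 + int i * (int d * a 0)" if "i < k" for i
    using that
  proof (induction i)
    case (Suc i)
    then show ?case using step_eq[of i] d by (simp add: distrib_right)
  qed simp
qed

end

section \<open>Transfer to the sets \<open>A\<close> and \<open>H\<close>\<close>

lemma gen_sumset_enum:
  assumes "bij_betw a {..<k} A"
  shows "gen_sumset r h A = weight k a ` {l. config k r h l}"
proof (intro equalityI subsetI)
  have inj: "inj_on a {..<k}" and im: "A = a ` {..<k}"
    using assms by (auto simp: bij_betw_def)
  fix s
  {
    assume "s \<in> gen_sumset r h A"
    then obtain f where f: "s = (\<Sum>x\<in>A. int (f x) * x)" "\<forall>x\<in>A. f x \<le> r" "(\<Sum>x\<in>A. f x) = h"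
      unfolding gen_sumset_def by blast
    have "config k r h (f \<circ> a)" using f(2,3) im inj by (auto simp: config_def sum.reindex)
    moreover have "s = weight k a (f \<circ> a)"
      unfolding f(1) im weight_def using inj by (simp add: sum.reindex mult.commute)
    ultimately show "s \<in> weight k a ` {l. config k r h l}" by blast
  next
    assume "s \<in> weight k a ` {l. config k r h l}"
    then obtain l where l: "config k r h l" "s = weight k a l" by blast
    \<comment> \<open>Only the values of \<open>f\<close> on \<open>A\<close> matter; elsewhere the
      inverse is unspecified.\<close>
    define f where "f = l \<circ> inv_into {..<k} a"
    have fa: "f (a i) = l i" if "i < k" for i using that inj by (simp add: f_def)
    have "s = (\<Sum>x\<in>A. int (f x) * x)"
      unfolding l(2) im weight_def using inj fa by (simp add: sum.reindex mult.commute)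
    moreover have "(\<forall>x\<in>A. f x \<le> r) \<and> (\<Sum>x\<in>A. f x) = h"
      using l(1) fa inj by (auto simp: im config_def sum.reindex)
    ultimately show "s \<in> gen_sumset r h A" unfolding gen_sumset_def by blast
  }
qed

theorem theorem3p1:
  fixes r k t :: nat and A :: "int set" and H :: "nat set"
  assumes "r \<ge> 1"
    and "finite A" and "card A = k" and "k \<ge> 6" and "\<forall>a\<in>A. a > 0"
    and "finite H" and "card H = t" and "t \<ge> 2" and "\<forall>h\<in>H. h > 0"
    and "r \<le> Max H" and "int (Max H) \<le> (int k - 1) * int r - 1"
    and "int (card (gen_sumset_family r H A)) = L_bound (int k) H r"
  shows "\<exists>d::nat. 1 \<le> d \<and> d \<le> r \<and> is_arith_prog d H \<and> is_arith_prog (int d * Min A) A"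
proof -
  define a where "a i = sorted_list_of_set A ! i" for i
  define h where "h = nth_elem H"
  have a_mono: "a i < a j" if "i < j" "j < k" for i j
    using sorted_wrt_nth_less[OF strict_sorted_list_of_set[of A] that(1)] that(2) assms(3)
    by (simp add: a_def)
  have bij: "bij_betw a {..<k} A"
    unfolding a_def[abs_def] using assms(2,3)
    by (intro bij_betw_nth) auto
  have A: "A = a ` {..<k}" using bij by (simp add: bij_betw_def)
  have h0: "h 0 = 0" by (simp add: h_def nth_elem_def)
  have hS: "h (Suc i) = sorted_list_of_set H ! i" for i by (simp add: h_def nth_elem_def)
  have H: "H = (\<lambda>i. h (Suc i)) ` {..<t}"
    using bij_betw_nth[of "sorted_list_of_set H" "{..<t}" H] assms(6,7) by (auto simp: hS bij_betw_def)
  have h_mono: "h i < h (Suc i)" if "i < t" for i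
  proof (cases i)
    case 0
    then show ?thesis using H assms(9) that h0 by auto
  next
    case (Suc j)
    then show ?thesis
      using sorted_wrt_nth_less[OF strict_sorted_list_of_set[of H], of j "Suc j"] assms(7) that
      by (simp add: hS)
  qed
  have "h t \<in> H" using H assms(8) by (auto intro!: image_eqI[of _ _ "t - 1"])
  then have "h t \<le> Max H" using assms(6) by simp
  then have "int (h t) < int ((k - 1) * r)"
    using assms(4,11) by (simp add: of_nat_diff)
  then have h_max: "h t < (k - 1) * r" by linarith
  interpret sumset_chain r k t a h
    by unfold_locales (use assms A a_mono h0 h_mono h_max in auto)
  have "val ` configs = gen_sumset_family r H A"
  proof -
    have "val ` configs = (\<Union>i\<in>{1..t}. weight k a ` {l. config k r (h i) l})"
      by (force simp: configs_def val_def)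
    also have "\<dots> = (\<Union>i\<in>{1..t}. gen_sumset r (h i) A)"
      by (simp add: gen_sumset_enum[OF bij])
    also have "{1..t} = Suc ` {..<t}"
      by (simp add: image_Suc_lessThan)
    also have "(\<Union>i\<in>Suc ` {..<t}. gen_sumset r (h i) A) = gen_sumset_family r H A"
      by (subst H) (simp add: gen_sumset_family_def)
    finally show ?thesis .
  qed
  \<comment> \<open>Since the number of sums equals \<open>L_bound\<close>, this inequality supplies
    \<open>card_values\<close>.\<close>
  moreover have "L_bound (int k) H r \<le> chain_length"
    unfolding L_bound_def Let_def chain_length_def assms(7) h_def[symmetric]
  proof (rule sum_mono)
    fix i assume i: "i \<in> {1..t}"
    then have "h (i - 1) < h i" using h_mono[of "i - 1"] by (cases i) auto
    moreover have "h i < k * r" using h_bounds(1)[of i] i by (auto simp: diff_mult_distrib)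
    ultimately show "int r * (int (h i div r) - int (h (i - 1) div r)) * (int k - int (h i div r)) +
        (int (h i mod r) - int (h (i - 1) mod r)) * (int k - int (h i div r) - 1) -
        max (int (h i mod r)) (int (h (i - 1) mod r)) * (int (h i div r) - int (h (i - 1) div r)) + 1
      \<le> weight k int (top_config k r (h i)) - weight k int (top_config k r (h (i - 1))) -
        weight k int (bottom r (gap i)) + 1"
      using L_bound_summand[OF assms(1), of "h (i - 1)" "h i" k] by (simp add: gap_def)
  qed
  ultimately interpret extremal_sumset_chain r k t a h
    by unfold_locales (use assms(12) in simp)
  obtain d where d: "1 \<le> d" "d \<le> r" "\<And>i. i < t \<Longrightarrow> h (Suc i) = h 1 + i * d"
    "\<And>i. i < k \<Longrightarrow> a i = a 0 + int i * (int d * a 0)"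
    using progressions by metis
  have minA: "Min A = a 0"
  proof (rule Min_eqI)
    fix x assume "x \<in> A"
    then obtain i where "i < k" "x = a i" using A by auto
    then show "a 0 \<le> x" using a_mono[of 0 i] by (cases "i = 0") auto
  qed (use A assms in auto)
  have "A = (\<lambda>i. a 0 + int i * (int d * a 0)) ` {..<k}"
    unfolding A by (rule image_cong[OF refl], rule d(4)) simp
  then have "A = {a 0 + of_nat i * (int d * a 0) | i. i < k}" by auto
  then have "is_arith_prog (int d * Min A) A"
    unfolding is_arith_prog_def minA using assms(4) by (intro exI[of _ "a 0"] exI[of _ k]) simp
  moreover have "H = (\<lambda>i. h 1 + i * d) ` {..<t}"
    unfolding H by (rule image_cong[OF refl], rule d(3)) simp
  then have "H = {h 1 + of_nat i * d | i. i < t}" by auto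
  then have "is_arith_prog d H"
    unfolding is_arith_prog_def using assms(8) by (intro exI[of _ "h 1"] exI[of _ t]) simp
  ultimately show ?thesis using d(1,2) by blast
qed

end
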